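(* Let $M$ be a surface in $\mathbb{R}^n$ (with the induced Riemannian metric) that admits a conformal polynomial parameterization. Then $M$ is a minimal surface, i.e. its mean curvature vanishes identically.
   Context: A polynomial parameterization of a surface $M$ in $\mathbb{R}^n$ is a regular map (immersion) $\bar X=(X_1,\dots,X_n):\mathbb{R}^2\to\mathbb{R}^n$, with image $M$, all of whose components are real polynomials in the parameters $x,y$. It is conformal if $\bar X_x\cdot\bar X_x=\bar X_y\cdot\bar X_y$ and $\bar X_x\cdot\bar X_y=0$ at every point, where subscripts denote partial derivatives and $\cdot$ is the Euclidean inner product. For $n=3$ the mean curvature is $H=\frac12\frac{Eg-2fF+Ge}{EG-F^2}$, with $E=\bar X_x\cdot\bar X_x$, $F=\bar X_x\cdot\bar X_y$, $G=\bar X_y\cdot\bar X_y$ and $e,f,g$ the inner products of $\bar X_{xx},\bar X_{xy},\bar X_{yy}$ with the unit normal to the surface; for general $n$, minimal means that the mean curvature vector (half the trace, with respect to the induced metric, of the normal-bundle-valued second fundamental form) is zero. *)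

theory Defs
  imports "HOL-Analysis.Analysis"
begin

text \<open>
  The parameter plane is \<^typ>\<open>real^2\<close>, with \<open>x = p $ 1\<close> and \<open>y = p $ 2\<close>. All geometric quantities
  are attached to a parameter point \<open>p\<close> rather than to the point \<open>X p\<close> of the image: an
  immersion may have self-intersections, where tangent plane and curvature depend on the sheet.
\<close>

definition partial :: "2 \<Rightarrow> (real^2 \<Rightarrow> 'a::real_normed_vector) \<Rightarrow> real^2 \<Rightarrow> 'a" where
  "partial i X p = vector_derivative (\<lambda>t. X (p + t *\<^sub>R axis i 1)) (at 0)"

definition immersion :: "(real^2 \<Rightarrow> real^'n) \<Rightarrow> bool" where
  "immersion X \<longleftrightarrow> (\<forall>p. \<exists>D. (X has_derivative D) (at p) \<and> inj D)"

definition polynomial_parameterization :: "(real^2 \<Rightarrow> real^'n) \<Rightarrow> (real^'n) set \<Rightarrow> bool" where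
  "polynomial_parameterization X M \<longleftrightarrow>
     (\<forall>i. real_polynomial_function (\<lambda>p. X p $ i)) \<and> immersion X \<and> range X = M"

definition conformal :: "(real^2 \<Rightarrow> real^'n) \<Rightarrow> bool" where
  "conformal X \<longleftrightarrow>
     (\<forall>p. partial 1 X p \<bullet> partial 1 X p = partial 2 X p \<bullet> partial 2 X p \<and>
          partial 1 X p \<bullet> partial 2 X p = 0)"

definition tangent_space :: "(real^2 \<Rightarrow> real^'n) \<Rightarrow> real^2 \<Rightarrow> (real^'n) set" where
  "tangent_space X p = span {partial 1 X p, partial 2 X p}"

text \<open>The orthogonal projection of \<open>v\<close> onto the normal space at \<open>p\<close>.\<close>

definition normal_part :: "(real^2 \<Rightarrow> real^'n) \<Rightarrow> real^2 \<Rightarrow> real^'n \<Rightarrow> real^'n" where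
  "normal_part X p v =
     (THE w. (\<forall>u \<in> tangent_space X p. orthogonal u w) \<and> v - w \<in> tangent_space X p)"

text \<open>
  The matrix of the induced metric (the first fundamental form, with entries \<open>E, F, F, G\<close>) and the
  vector-valued coefficients of the second fundamental form in the coordinate frame. The latter
  are the normal parts of the second partial derivatives, since the ambient connection is flat.
\<close>

definition induced_metric :: "(real^2 \<Rightarrow> real^'n) \<Rightarrow> real^2 \<Rightarrow> real^2^2" where
  "induced_metric X p = (\<chi> i j. partial i X p \<bullet> partial j X p)"

definition second_fundamental_form :: "(real^2 \<Rightarrow> real^'n) \<Rightarrow> real^2 \<Rightarrow> 2 \<Rightarrow> 2 \<Rightarrow> real^'n" where
  "second_fundamental_form X p i j = normal_part X p (partial i (partial j X) p)"

text \<open>Half the trace of the second fundamental form with respect to the induced metric.\<close>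

definition mean_curvature_vector :: "(real^2 \<Rightarrow> real^'n) \<Rightarrow> real^2 \<Rightarrow> real^'n" where
  "mean_curvature_vector X p =
     (1/2) *\<^sub>R (\<Sum>i\<in>UNIV. \<Sum>j\<in>UNIV.
       matrix_inv (induced_metric X p) $ i $ j *\<^sub>R second_fundamental_form X p i j)"

definition minimal :: "(real^2 \<Rightarrow> real^'n) \<Rightarrow> bool" where
  "minimal X \<longleftrightarrow> (\<forall>p. mean_curvature_vector X p = 0)"

end

theory Submission
  imports Defs
begin

text \<open>
  The components of \<open>X\<close> are polynomials in \<open>z = x + iy\<close> and \<open>w = x - iy\<close> with hermitian coefficients
  \<open>c\<^sub>j\<^sub>k\<close> (of \<open>w\<^sup>j z\<^sup>k\<close>, in \<open>\<complex>\<^sup>n\<close>), and \<open>X\<close> is conformal iff \<open>X\<^sub>z \<bullet> X\<^sub>z = 0\<close> identically in \<open>z\<close> and \<open>w\<close>.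
  Suppose \<open>X\<close> is not harmonic, and let \<open>d\<close> be the largest total degree of a monomial of \<open>X\<close> that
  contains both \<open>z\<close> and \<open>w\<close>. The holomorphic part of \<open>X\<^sub>z\<close> does not contribute to the coefficient of
  \<open>w\<^sup>d z\<^sup>d\<^sup>-\<^sup>2\<close> in \<open>X\<^sub>z \<bullet> X\<^sub>z\<close>, because mixed monomials have \<open>w\<close>-degree less than \<open>d\<close>. So this
  coefficient is the sum of \<open>j k |c\<^sub>j\<^sub>k|\<^sup>2\<close> over \<open>j + k = d\<close>, which is positive: a contradiction.
  Hence \<open>X\<close> is harmonic, and in conformal coordinates the mean curvature vector is a multiple of the
  normal part of the Laplacian of \<open>X\<close>.
\<close>

section \<open>Polynomials in \<open>z\<close> and its conjugate\<close>

text \<open>The outer variable is \<open>w\<close>, the inner one is \<open>z\<close>.\<close>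

definition eval2 :: "complex poly poly \<Rightarrow> complex \<Rightarrow> complex \<Rightarrow> complex" where
  "eval2 P z w = poly (poly P [:w:]) z"

abbreviation coeff2 :: "complex poly poly \<Rightarrow> nat \<Rightarrow> nat \<Rightarrow> complex" where
  "coeff2 P j k \<equiv> coeff (coeff P j) k"

abbreviation dz :: "complex poly poly \<Rightarrow> complex poly poly" where
  "dz P \<equiv> map_poly pderiv P"

abbreviation dw :: "complex poly poly \<Rightarrow> complex poly poly" where
  "dw P \<equiv> pderiv P"

lemma eval2_simps [simp]:
  "eval2 0 z w = 0"
  "eval2 (pCons q P) z w = poly q z + w * eval2 P z w"
  "eval2 (P + Q) z w = eval2 P z w + eval2 Q z w"
  "eval2 (P * Q) z w = eval2 P z w * eval2 Q z w"
  "eval2 (smult q P) z w = poly q z * eval2 P z w"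
  by (simp_all add: eval2_def)

lemma eval2_sum: "eval2 (\<Sum>i\<in>A. P i) z w = (\<Sum>i\<in>A. eval2 (P i) z w)"
  by (induction A rule: infinite_finite_induct) simp_all

text \<open>The two variables move along independent lines; \<open>d = cnj b\<close> will give
  derivatives in the real parameter plane.\<close>

lemma eval2_has_vector_derivative:
  "((\<lambda>t. eval2 P (a + of_real t * b) (c + of_real t * d)) has_vector_derivative
     b * eval2 (dz P) (a + of_real t * b) (c + of_real t * d)
     + d * eval2 (dw P) (a + of_real t * b) (c + of_real t * d)) (at t)"
proof (induction P)
  case 0
  then show ?case by simp
next
  case (pCons q P)
  have line: "((\<lambda>t. u + of_real t * v) has_vector_derivative v) (at t)" for u v :: complex
    by (auto intro!: derivative_eq_intros)
  have q: "((\<lambda>t. poly q (a + of_real t * b)) has_vector_derivative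
      b * poly (pderiv q) (a + of_real t * b)) (at t)"
    using field_vector_diff_chain_at[OF line[of a b] poly_DERIV[of q]] by (simp add: o_def)
  show ?case
    using has_vector_derivative_add[OF q has_vector_derivative_mult[OF line[of c d] pCons.IH]]
    by (simp add: map_poly_pCons pderiv_pCons algebra_simps)
qed

lemma ex_poly_eval2_line: "\<exists>R. \<forall>t. poly R t = eval2 P (a + t * b) (c + t * d)"
proof (induction P)
  case 0
  then show ?case by (auto intro: exI[of _ 0])
next
  case (pCons q P)
  then obtain R where "\<And>t. poly R t = eval2 P (a + t * b) (c + t * d)" by blast
  then have "\<forall>t. poly (pcompose q [:a, b:] + [:c, d:] * R) t =
      eval2 (pCons q P) (a + t * b) (c + t * d)"
    by (simp add: poly_pcompose algebra_simps)
  then show ?case by blast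
qed

text \<open>Along a line \<open>eval2 P\<close> is a polynomial in one variable, and one that
  vanishes at every real number has infinitely many roots.\<close>

lemma eval2_line_zero:
  assumes "\<And>t::real. eval2 P (a + of_real t * b) (c + of_real t * d) = 0"
  shows "eval2 P (a + s * b) (c + s * d) = 0"
proof -
  obtain R where R: "\<And>t. poly R t = eval2 P (a + t * b) (c + t * d)"
    using ex_poly_eval2_line by metis
  have "range (of_real :: real \<Rightarrow> complex) \<subseteq> {t. poly R t = 0}"
    using assms R by auto
  moreover have "infinite (range (of_real :: real \<Rightarrow> complex))"
    by (simp add: finite_image_iff inj_of_real infinite_UNIV_char_0)
  ultimately have "R = 0"
    using poly_roots_finite infinite_super by blast
  then show ?thesis using R[of s] by simp
qed

text \<open>For each \<open>w\<close> the polynomial in \<open>z\<close> is zero, so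
  \<open>P\<close>, over the integral domain \<open>complex poly\<close>, has every constant
  \<open>[:w:]\<close> as a root.\<close>

lemma eval2_eq_0_imp:
  assumes "\<And>z w. eval2 P z w = 0"
  shows "P = 0"
proof -
  have "poly P [:w:] = 0" for w
    using assms poly_all_0_iff_0[of "poly P [:w:]"] by (simp add: eval2_def)
  then have "range (\<lambda>w. [:w:]) \<subseteq> {q. poly P q = 0}" by auto
  moreover have "infinite (range (\<lambda>w::complex. [:w:]))"
    by (simp add: finite_image_iff inj_def infinite_UNIV_char_0)
  ultimately show ?thesis
    using poly_roots_finite infinite_super by blast
qed

text \<open>The two real coordinates are complexified one after the other.\<close>

lemma eval2_cnj_eq_0_imp:
  assumes "\<And>z. eval2 P z (cnj z) = 0"
  shows "P = 0"
proof (rule eval2_eq_0_imp)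
  have "eval2 P (\<i> * of_real y + of_real x * 1) (- \<i> * of_real y + of_real x * 1) = 0" for x y
    using assms[of "\<i> * of_real y + of_real x * 1"] by simp
  then have "eval2 P (\<i> * of_real y + s * 1) (- \<i> * of_real y + s * 1) = 0" for s y
    by (rule eval2_line_zero)
  then have "eval2 P (s + of_real y * \<i>) (s + of_real y * (- \<i>)) = 0" for s y
    by (simp add: algebra_simps)
  then have *: "eval2 P (s + u * \<i>) (s + u * (- \<i>)) = 0" for s u
    by (rule eval2_line_zero)
  show "eval2 P z w = 0" for z w
    \<comment> \<open>These values solve \<open>s + u * \<i> = z\<close> and
      \<open>s - u * \<i> = w\<close>.\<close>
    using *[of "(z + w) / 2" "(z - w) / (2 * \<i>)"] by (simp add: field_simps)
qed

section \<open>Hermitian representations of real polynomial functions\<close>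

text \<open>Conjugating the value at \<open>w = cnj z\<close> swaps the two exponents, so this
  symmetry is the coefficient form of being real-valued there. It later turns products of
  coefficients into squared moduli.\<close>

definition hermitian :: "complex poly poly \<Rightarrow> bool" where
  "hermitian P \<longleftrightarrow> (\<forall>j k. coeff2 P j k = cnj (coeff2 P k j))"

definition cplx :: "real^2 \<Rightarrow> complex" where
  "cplx p = Complex (p $ 1) (p $ 2)"

definition represents :: "complex poly poly \<Rightarrow> (real^2 \<Rightarrow> real) \<Rightarrow> bool" where
  "represents P f \<longleftrightarrow> (\<forall>p. eval2 P (cplx p) (cnj (cplx p)) = of_real (f p))"

lemma coeff2_mult:
  "coeff2 (P * Q) j k = (\<Sum>i\<le>j. \<Sum>l\<le>k. coeff2 P i l * coeff2 Q (j - i) (k - l))"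
  by (simp add: coeff_mult coeff_sum)

lemma cnj_coeff2: "hermitian P \<Longrightarrow> cnj (coeff2 P j k) = coeff2 P k j"
  unfolding hermitian_def by metis

lemma hermitian_add: "hermitian P \<Longrightarrow> hermitian Q \<Longrightarrow> hermitian (P + Q)"
  unfolding hermitian_def coeff_add complex_cnj_add by metis

lemma hermitian_mult:
  assumes "hermitian P" "hermitian Q"
  shows "hermitian (P * Q)"
  unfolding hermitian_def
proof (intro allI)
  fix j k
  have "cnj (coeff2 (P * Q) k j) =
      (\<Sum>i\<le>k. \<Sum>l\<le>j. cnj (coeff2 P i l) * cnj (coeff2 Q (k - i) (j - l)))"
    by (simp add: coeff2_mult)
  also have "\<dots> = (\<Sum>i\<le>k. \<Sum>l\<le>j. coeff2 P l i * coeff2 Q (j - l) (k - i))"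
    by (simp only: cnj_coeff2[OF assms(1)] cnj_coeff2[OF assms(2)])
  also have "\<dots> = coeff2 (P * Q) j k"
    unfolding coeff2_mult by (rule sum.swap)
  finally show "coeff2 (P * Q) j k = cnj (coeff2 (P * Q) k j)" by simp
qed

lemma real_polynomial_function_represents:
  assumes "real_polynomial_function f"
  shows "\<exists>P. hermitian P \<and> represents P f"
  using assms
proof induction
  case (linear f)
  define a b where "a = f (axis 1 1)" and "b = f (axis 2 1)"
  \<comment> \<open>With z = x + iy, the form ax + by is twice the real part of
    \<open>\<alpha>\<close> z, that is, \<open>\<alpha>\<close> z plus its conjugate.\<close>
  define \<alpha> where "\<alpha> = Complex (a / 2) (- b / 2)"
  have f: "f p = p $ 1 * a + p $ 2 * b" for p
  proof -
    interpret bounded_linear f by fact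
    have "p = p $ 1 *\<^sub>R axis 1 1 + p $ 2 *\<^sub>R axis 2 1"
      by (simp add: vec_eq_iff forall_2 axis_def)
    then have "f p = f (p $ 1 *\<^sub>R axis 1 1 + p $ 2 *\<^sub>R axis 2 1)"
      by (rule arg_cong)
    then show ?thesis by (simp add: add scale a_def b_def)
  qed
  have "hermitian [:[:0, \<alpha>:], [:cnj \<alpha>:]:]"
    by (auto simp: hermitian_def coeff_pCons split: nat.splits)
  moreover have "represents [:[:0, \<alpha>:], [:cnj \<alpha>:]:] f"
    by (auto simp: represents_def cplx_def \<alpha>_def complex_eq_iff f field_simps)
  ultimately show ?case by blast
next
  case (const c)
  have "hermitian [:[:of_real c:]:]"
    by (auto simp: hermitian_def coeff_pCons split: nat.splits)
  moreover have "represents [:[:of_real c:]:] (\<lambda>p. c)"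
    by (simp add: represents_def)
  ultimately show ?case by blast
next
  case (add f g)
  then obtain P Q where "hermitian P" "represents P f" "hermitian Q" "represents Q g" by blast
  then have "hermitian (P + Q)" "represents (P + Q) (\<lambda>p. f p + g p)"
    by (simp_all add: hermitian_add represents_def)
  then show ?case by blast
next
  case (mult f g)
  then obtain P Q where "hermitian P" "represents P f" "hermitian Q" "represents Q g" by blast
  then have "hermitian (P * Q)" "represents (P * Q) (\<lambda>p. f p * g p)"
    by (simp_all add: hermitian_mult represents_def)
  then show ?case by blast
qed

definition direction :: "2 \<Rightarrow> complex" where
  "direction i = (if i = 1 then 1 else \<i>)"

text \<open>Chain rule: a step along axis \<open>i\<close> moves z by \<open>direction i\<close> and
  its conjugate by \<open>cnj (direction i)\<close>.\<close>

definition partial_poly :: "2 \<Rightarrow> complex poly poly \<Rightarrow> complex poly poly" where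
  "partial_poly i P = smult [:direction i:] (dz P) + smult [:cnj (direction i):] (dw P)"

lemma cplx_line: "cplx (p + t *\<^sub>R axis i 1) = cplx p + of_real t * direction i"
  using exhaust_2[of i] by (auto simp: cplx_def direction_def axis_def complex_eq_iff)

lemma represents_partial:
  fixes X :: "real^2 \<Rightarrow> real^'n"
  assumes "\<And>k. represents (P k) (\<lambda>p. X p $ k)"
  shows "represents (partial_poly i (P k)) (\<lambda>p. partial i X p $ k)"
  unfolding represents_def
proof
  fix p
  define D where "D k = eval2 (partial_poly i (P k)) (cplx p) (cnj (cplx p))" for k
  have d: "((\<lambda>t. of_real (X (p + t *\<^sub>R axis i 1) $ k)) has_vector_derivative D k) (at 0)" for k
  proof -
    have "(\<lambda>t. eval2 (P k) (cplx p + of_real t * direction i)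
        (cnj (cplx p) + of_real t * cnj (direction i)))
      = (\<lambda>t. of_real (X (p + t *\<^sub>R axis i 1) $ k))"
    proof
      fix t
      show "eval2 (P k) (cplx p + of_real t * direction i)
          (cnj (cplx p) + of_real t * cnj (direction i)) = of_real (X (p + t *\<^sub>R axis i 1) $ k)"
        using assms[of k, unfolded represents_def, rule_format, of "p + t *\<^sub>R axis i 1"]
        by (simp add: cplx_line)
    qed
    then show ?thesis
      using eval2_has_vector_derivative[of "P k" "cplx p" "direction i" "cnj (cplx p)"
          "cnj (direction i)" 0]
      by (simp add: D_def partial_poly_def)
  qed
  have re: "((\<lambda>t. X (p + t *\<^sub>R axis i 1) $ k) has_vector_derivative Re (D k)) (at 0)" for k
    using bounded_linear.has_vector_derivative[OF bounded_linear_Re d[of k]] by simp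
  \<comment> \<open>Embedding the real derivative back into the complex numbers gives a second
    derivative of the same function; uniqueness then shows that \<open>D k\<close> is real.\<close>
  have "((\<lambda>t. complex_of_real (X (p + t *\<^sub>R axis i 1) $ k)) has_vector_derivative
      of_real (Re (D k))) (at 0)"
    using bounded_linear.has_vector_derivative[OF bounded_linear_of_real re[of k]] by simp
  with d have D: "D k = of_real (Re (D k))"
    using vector_derivative_unique_at by blast
  have "((\<lambda>t. X (p + t *\<^sub>R axis i 1)) has_vector_derivative (\<chi> k. Re (D k))) (at 0)"
    using re unfolding has_vector_derivative_def
    by (subst has_derivative_componentwise_within) (auto simp: Basis_vec_def inner_axis)
  then have "partial i X p = (\<chi> k. Re (D k))"
    by (simp add: partial_def vector_derivative_at)
  with D show "eval2 (partial_poly i (P k)) (cplx p) (cnj (cplx p)) = of_real (partial i X p $ k)"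
    by (simp add: D_def)
qed

section \<open>Isotropic polynomial maps are harmonic\<close>

lemma coeff2_dz: "coeff2 (dz P) j k = of_nat (Suc k) * coeff2 P j (Suc k)"
  by (simp add: coeff_map_poly coeff_pderiv)

lemma coeff2_dw: "coeff2 (dw P) j k = of_nat (Suc j) * coeff2 P (Suc j) k"
  by (simp add: coeff_pderiv of_nat_poly del: of_nat_Suc)

lemma dz_add: "dz (P + Q) = dz P + dz Q"
  by (simp add: poly_eq_iff coeff2_dz distrib_left del: of_nat_Suc)

lemma dz_smult: "dz (smult [:c:] P) = smult [:c:] (dz P)"
  by (simp add: poly_eq_iff coeff2_dz del: of_nat_Suc)

text \<open>The convolution pairs the coefficient at (j, k+1) with the one at (d-j, d-1-k). On the
  diagonal j+k+1 = d these indices are transposed, so hermitian symmetry yields a squared modulus;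
  off it the degree bound kills a factor.\<close>

lemma coeff2_dz_square:
  assumes "hermitian P"
    and bound: "\<And>j k. j \<ge> 1 \<Longrightarrow> k \<ge> 1 \<Longrightarrow> coeff2 P j k \<noteq> 0 \<Longrightarrow> j + k \<le> d"
    and "d \<ge> 2"
  shows "coeff2 (dz P * dz P) d (d - 2) =
    of_real (\<Sum>j\<le>d. \<Sum>k\<le>d - 2.
      if j + Suc k = d then of_nat (Suc k * j) * (cmod (coeff2 P j (Suc k)))\<^sup>2 else 0)"
  unfolding coeff2_mult of_real_sum
proof (intro sum.cong refl)
  fix j k assume "j \<in> {..d}" "k \<in> {..d - 2}"
  then have jk: "j \<le> d" "k \<le> d - 2" by auto
  define l where "l = d - 2 - k"
  have l: "d = k + l + 2" using jk \<open>d \<ge> 2\<close> by (simp add: l_def)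
  show "coeff2 (dz P) j k * coeff2 (dz P) (d - j) (d - 2 - k) = of_real
    (if j + Suc k = d then of_nat (Suc k * j) * (cmod (coeff2 P j (Suc k)))\<^sup>2 else 0)"
  proof (cases "j + Suc k = d")
    case True
    then have j: "j = Suc l" "d - j = Suc k" using l by auto
    define c where "c = coeff2 P (Suc l) (Suc k)"
    have "coeff2 P (Suc k) (Suc l) = cnj c"
      unfolding c_def by (rule cnj_coeff2[OF assms(1), symmetric])
    then have "coeff2 (dz P) j k * coeff2 (dz P) (d - j) (d - 2 - k)
        = of_nat (Suc k * j) * (c * cnj c)"
      unfolding j(2) l_def[symmetric] unfolding j(1) coeff2_dz c_def[symmetric]
      by (simp only: of_nat_mult mult_ac)
    then show ?thesis
      using True by (simp add: j(1) flip: c_def complex_norm_square)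
  next
    case False
    have "coeff2 P j (Suc k) = 0 \<or> coeff2 P (d - j) (Suc l) = 0"
    proof (rule ccontr)
      assume "\<not> ?thesis"
      then have nz: "coeff2 P j (Suc k) \<noteq> 0" "coeff2 P (d - j) (Suc l) \<noteq> 0" by auto
      \<comment> \<open>If \<open>j = 0\<close>, the second factor would be a mixed monomial of
        w-degree d, hence of total degree above d; \<open>j = d\<close> fails likewise for the
        first.\<close>
      have "j \<noteq> 0" using bound[of "d - j" "Suc l"] nz \<open>d \<ge> 2\<close> by (intro notI) simp
      moreover have "j \<noteq> d" using bound[of j "Suc k"] nz \<open>d \<ge> 2\<close> by (intro notI) simp
      ultimately have "j + Suc k \<le> d" "d - j + Suc l \<le> d"
        using bound[of j "Suc k"] bound[of "d - j" "Suc l"] nz jk by simp_all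
      \<comment> \<open>The two left-hand sides add up to 2d, so both bounds are equalities,
        contrary to \<open>False\<close>.\<close>
      then show False using False l jk by linarith
    qed
    then show ?thesis using False by (auto simp: coeff2_dz l_def)
  qed
qed

lemma isotropic_imp_harmonic:
  fixes P :: "'n::finite \<Rightarrow> complex poly poly"
  assumes herm: "\<And>i. hermitian (P i)" and iso: "(\<Sum>i\<in>UNIV. dz (P i) * dz (P i)) = 0"
    and "j \<ge> 1" "k \<ge> 1"
  shows "coeff2 (P i) j k = 0"
proof (rule ccontr)
  assume nz: "coeff2 (P i) j k \<noteq> 0"
  define mixed where "mixed = {(i, j, k). j \<ge> 1 \<and> k \<ge> 1 \<and> coeff2 (P i) j k \<noteq> 0}"
  define B where "B = (\<Union>i. (\<lambda>(j, k). (i, j, k)) `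
    (SIGMA j:{..degree (P i)}. {..degree (coeff (P i) j)}))"
  have "finite B" unfolding B_def by (intro finite_UN_I finite_imageI finite_SigmaI) auto
  moreover have "mixed \<subseteq> B"
    unfolding mixed_def B_def by (force simp: image_iff intro: le_degree)
  ultimately have fin: "finite mixed" by (rule finite_subset[rotated])
  have ne: "mixed \<noteq> {}" using assms(3,4) nz by (auto simp: mixed_def)
  \<comment> \<open>The maximum runs over all components at once: only the sum of the squares
    vanishes, so one coefficient must be read off in every component.\<close>
  define d where "d = Max ((\<lambda>(i, j, k). j + k) ` mixed)"
  have bound: "b + c \<le> d" if "b \<ge> 1" "c \<ge> 1" "coeff2 (P a) b c \<noteq> 0" for a b c
    unfolding d_def using that fin by (intro Max_ge) (force simp: mixed_def image_iff)+
  have "d \<in> (\<lambda>(i, j, k). j + k) ` mixed"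
    unfolding d_def using fin ne by (intro Max_in) auto
  then obtain a b c where abc: "b \<ge> 1" "c \<ge> 1" "coeff2 (P a) b c \<noteq> 0" "d = b + c"
    by (auto simp: mixed_def)
  define s where "s i j k = (if j + Suc k = d
    then real (Suc k * j) * (cmod (coeff2 (P i) j (Suc k)))\<^sup>2 else 0)" for i j k
  have nonneg: "s i j k \<ge> 0" for i j k by (simp add: s_def)
  have "d \<ge> 2" using abc by simp
  then have "coeff2 (dz (P i) * dz (P i)) d (d - 2) = of_real (\<Sum>j\<le>d. \<Sum>k\<le>d - 2. s i j k)" for i
    unfolding s_def using coeff2_dz_square[of "P i" d] herm bound by blast
  then have "of_real (\<Sum>i\<in>UNIV. \<Sum>j\<le>d. \<Sum>k\<le>d - 2. s i j k)
      = coeff2 (\<Sum>i\<in>UNIV. dz (P i) * dz (P i)) d (d - 2)"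
    by (simp only: coeff_sum of_real_sum)
  then have "(\<Sum>i\<in>UNIV. \<Sum>j\<le>d. \<Sum>k\<le>d - 2. s i j k) = 0"
    unfolding iso by (simp del: of_real_sum)
  then have "(\<Sum>j\<le>d. \<Sum>k\<le>d - 2. s a j k) = 0"
    by (simp add: sum_nonneg_eq_0_iff sum_nonneg nonneg)
  then have "(\<Sum>k\<le>d - 2. s a b k) = 0"
    using abc by (simp add: sum_nonneg_eq_0_iff sum_nonneg nonneg)
  \<comment> \<open>The index is \<open>c - 1\<close> because \<open>dz\<close> lowers the
    z-exponent: this is the term of the monomial that attains the maximal degree.\<close>
  then have "s a b (c - 1) = 0"
    using abc by (subst (asm) sum_nonneg_eq_0_iff) (auto simp: nonneg)
  then show False using abc by (simp add: s_def)
qed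

lemma conformal_polynomial_laplacian:
  fixes X :: "real^2 \<Rightarrow> real^'n"
  assumes poly: "\<And>i. real_polynomial_function (\<lambda>p. X p $ i)" and conf: "conformal X"
  shows "partial 1 (partial 1 X) p + partial 2 (partial 2 X) p = 0"
proof -
  obtain P where herm: "\<And>k. hermitian (P k)" and rep: "\<And>k. represents (P k) (\<lambda>p. X p $ k)"
    using real_polynomial_function_represents[OF poly] by metis
  have rep1: "represents (partial_poly i (P k)) (\<lambda>p. partial i X p $ k)" for i k
    by (intro represents_partial rep)
  have rep2: "represents (partial_poly i (partial_poly i (P k)))
      (\<lambda>p. partial i (partial i X) p $ k)" for i k
    using represents_partial[of "\<lambda>k. partial_poly i (P k)", OF rep1] .
  have "(\<Sum>k\<in>UNIV. dz (P k) * dz (P k)) = 0"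
  proof (rule eval2_cnj_eq_0_imp)
    fix z
    define q :: "real^2" where "q = vector [Re z, Im z]"
    have z: "cplx q = z" by (simp add: q_def cplx_def)
    \<comment> \<open>Wirtinger derivative: twice the z-derivative is the x-derivative minus i times
      the y-derivative.\<close>
    have dz: "2 * eval2 (dz (P k)) z (cnj z) =
        of_real (partial 1 X q $ k) - \<i> * of_real (partial 2 X q $ k)" for k
      unfolding complex_eq_iff
      using rep1[of 1 k, unfolded represents_def, rule_format, of q]
        rep1[of 2 k, unfolded represents_def, rule_format, of q]
      by (simp add: z partial_poly_def direction_def complex_eq_iff)
    have "4 * eval2 (\<Sum>k\<in>UNIV. dz (P k) * dz (P k)) z (cnj z)
        = (\<Sum>k\<in>UNIV. (2 * eval2 (dz (P k)) z (cnj z))\<^sup>2)"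
      by (simp add: eval2_sum sum_distrib_left power2_eq_square mult_ac)
    \<comment> \<open>The real and imaginary parts are exactly the two conformality
      conditions.\<close>
    also have "\<dots> = of_real (partial 1 X q \<bullet> partial 1 X q) - of_real (partial 2 X q \<bullet> partial 2 X q)
        - 2 * \<i> * of_real (partial 1 X q \<bullet> partial 2 X q)"
      unfolding dz inner_vec_def
      by (simp add: power2_eq_square algebra_simps sum.distrib sum_subtractf sum_distrib_left)
    also have "\<dots> = 0" using conf by (simp add: conformal_def)
    finally show "eval2 (\<Sum>k\<in>UNIV. dz (P k) * dz (P k)) z (cnj z) = 0" by simp
  qed
  then have harm: "coeff2 (P i) (Suc j) (Suc k) = 0" for i j k
    using isotropic_imp_harmonic[of P] herm by simp
  \<comment> \<open>Expanding the two squared operators cancels the pure second derivatives; what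
    remains are multiples of \<open>dz (dw (P k))\<close> and \<open>dw (dz (P k))\<close>, which
    see only mixed monomials.\<close>
  have lap: "partial_poly 1 (partial_poly 1 (P k)) + partial_poly 2 (partial_poly 2 (P k)) = 0" for k
  proof -
    have "coeff2 (dz (dw (P k))) a b = 0" "coeff2 (dw (dz (P k))) a b = 0" for a b
      by (simp_all add: coeff2_dz coeff2_dw harm del: of_nat_Suc)
    then have "dz (dw (P k)) = 0" "dw (dz (P k)) = 0"
      by (simp_all add: poly_eq_iff)
    moreover have "smult [:1:] Q = Q" "smult [:- 1:] Q = - Q" for Q :: "complex poly poly"
      by (simp_all add: poly_eq_iff)
    ultimately show ?thesis
      by (simp add: partial_poly_def direction_def dz_add dz_smult pderiv_add pderiv_smult
          smult_add_right)
  qed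
  show ?thesis
  proof (rule vec_eq_iff[THEN iffD2], rule allI)
    fix k
    have "of_real ((partial 1 (partial 1 X) p + partial 2 (partial 2 X) p) $ k)
      = eval2 (partial_poly 1 (partial_poly 1 (P k)) + partial_poly 2 (partial_poly 2 (P k)))
          (cplx p) (cnj (cplx p))"
      using rep2[of 1 k] rep2[of 2 k] by (simp add: represents_def)
    then show "(partial 1 (partial 1 X) p + partial 2 (partial 2 X) p) $ k = 0 $ k"
      by (simp add: lap del: eval2_simps(3) vector_add_component)
  qed
qed

section \<open>The mean curvature vector in conformal coordinates\<close>

text \<open>Two candidates for the normal part differ by a vector that is both tangent and normal,
  hence zero.\<close>

lemma normal_part_eqI:
  assumes "\<forall>u\<in>tangent_space X p. orthogonal u w" "v - w \<in> tangent_space X p"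
  shows "normal_part X p v = w"
  unfolding normal_part_def
proof (rule the_equality)
  show "(\<forall>u\<in>tangent_space X p. orthogonal u w) \<and> v - w \<in> tangent_space X p"
    using assms by blast
next
  fix w' assume w': "(\<forall>u\<in>tangent_space X p. orthogonal u w') \<and> v - w' \<in> tangent_space X p"
  then have "(v - w) - (v - w') \<in> tangent_space X p"
    using assms unfolding tangent_space_def by (blast intro: span_diff)
  then have "w' - w \<in> tangent_space X p" by simp
  then have "orthogonal (w' - w) (w' - w)"
    using assms w' by (auto simp: orthogonal_def inner_diff_right)
  then show "w' = w" by (simp add: orthogonal_def)
qed

lemma normal_part_minus: "normal_part X p (- v) = - normal_part X p v"
proof -
  obtain y w where y: "y \<in> tangent_space X p" and w: "\<And>u. u \<in> tangent_space X p \<Longrightarrow> orthogonal w u"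
    and v: "v = y + w"
    using orthogonal_subspace_decomp_exists[of "{partial 1 X p, partial 2 X p}" v]
    unfolding tangent_space_def by metis
  have "normal_part X p v = w"
    using y w v by (intro normal_part_eqI) (auto simp: orthogonal_commute)
  moreover have "normal_part X p (- v) = - w"
    using y w v unfolding tangent_space_def
    by (intro normal_part_eqI) (auto simp: orthogonal_def inner_commute tangent_space_def span_neg)
  ultimately show ?thesis by simp
qed

text \<open>By the chain rule the partial derivative is the image of an axis vector under the
  injective differential. This makes the conformal metric invertible.\<close>

lemma immersion_partial_nonzero:
  assumes "immersion X"
  shows "partial i X p \<noteq> 0"
proof -
  obtain D where D: "(X has_derivative D) (at p)" and inj: "inj D"
    using assms by (auto simp: immersion_def)
  have "((\<lambda>t. p + t *\<^sub>R axis i 1) has_vector_derivative axis i 1) (at (0::real))"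
    by (auto intro!: derivative_eq_intros)
  then have "((\<lambda>t. X (p + t *\<^sub>R axis i 1)) has_vector_derivative D (axis i 1)) (at 0)"
    using vector_derivative_diff_chain_within[of "\<lambda>t. p + t *\<^sub>R axis i 1" "axis i 1" 0 UNIV X D] D
    by (simp add: o_def has_derivative_at_withinI)
  then have "partial i X p = D (axis i 1)"
    by (simp add: partial_def vector_derivative_at)
  moreover have "D (axis i 1) \<noteq> D 0"
    using inj by (simp add: inj_eq)
  ultimately show ?thesis
    using linear_0[OF has_derivative_linear[OF D]] by simp
qed

lemma matrix_inv_mat:
  fixes c :: real
  assumes "c \<noteq> 0"
  shows "matrix_inv (mat c :: real^'m^'m) = mat (1 / c)"
proof -
  have *: "(mat a :: real^'m^'m) ** mat b = mat (a * b)" for a b :: real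
  proof -
    have "(\<Sum>k\<in>UNIV. (mat a :: real^'m^'m) $ i $ k * (mat b :: real^'m^'m) $ k $ j) =
        (\<Sum>k\<in>UNIV. if k = i then (mat (a * b) :: real^'m^'m) $ i $ j else 0)" for i j
      by (intro sum.cong) (auto simp: mat_def)
    then show ?thesis
      by (simp add: vec_eq_iff matrix_matrix_mult_def)
  qed
  \<comment> \<open>\<open>matrix_inv\<close> is a choice, so its inverse property becomes available
    only once some inverse is exhibited.\<close>
  have "\<exists>B. (mat c :: real^'m^'m) ** B = mat 1 \<and> B ** mat c = mat 1"
    using assms by (intro exI[of _ "mat (1 / c)"]) (simp add: *)
  then have "matrix_inv (mat c :: real^'m^'m) ** mat c = mat 1"
    unfolding matrix_inv_def by (rule someI2_ex) blast
  then have "matrix_inv (mat c) ** (mat c ** mat (1 / c)) = (mat (1 / c) :: real^'m^'m)"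
    by (simp only: matrix_mul_assoc matrix_mul_lid)
  then show ?thesis
    using assms by (simp add: *)
qed

text \<open>The induced metric is a nonzero multiple of the identity, so its inverse has no
  off-diagonal entries and the mixed terms drop out of the trace.\<close>

lemma conformal_mean_curvature_vector:
  assumes "immersion X" "conformal X"
  shows "mean_curvature_vector X p = (1 / (2 * (partial 1 X p \<bullet> partial 1 X p))) *\<^sub>R
    (normal_part X p (partial 1 (partial 1 X) p) + normal_part X p (partial 2 (partial 2 X) p))"
proof -
  define E where "E = partial 1 X p \<bullet> partial 1 X p"
  have "E \<noteq> 0" using immersion_partial_nonzero[OF assms(1)] by (simp add: E_def)
  moreover have "induced_metric X p = mat E"
    using assms(2)
    by (simp add: vec_eq_iff forall_2 induced_metric_def mat_def E_def conformal_def inner_commute)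
  ultimately have "matrix_inv (induced_metric X p) = mat (1 / E)"
    by (simp add: matrix_inv_mat)
  then show ?thesis
    unfolding mean_curvature_vector_def second_fundamental_form_def E_def[symmetric]
    by (simp add: sum_2 mat_def scaleR_add_right)
qed

theorem corollary4:
  fixes M :: "(real^'n) set" and X :: "real^2 \<Rightarrow> real^'n"
  assumes "polynomial_parameterization X M" and "conformal X"
  shows "minimal X"
  unfolding minimal_def
proof
  fix p
  have "partial 1 (partial 1 X) p + partial 2 (partial 2 X) p = 0"
    using assms
    by (intro conformal_polynomial_laplacian) (auto simp: polynomial_parameterization_def)
  \<comment> \<open>In this form \<open>normal_part_minus\<close> makes the two normal parts
    cancel.\<close>
  then have "partial 2 (partial 2 X) p = - partial 1 (partial 1 X) p"
    by (simp add: eq_neg_iff_add_eq_0 add.commute)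
  then show "mean_curvature_vector X p = 0"
    using assms
    by (simp add: conformal_mean_curvature_vector polynomial_parameterization_def normal_part_minus)
qed

end
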